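(* Let $\mathfrak{g}$ be a nonzero Lie algebra of arbitrary (possibly infinite) dimension over an arbitrary field. Then $\mathfrak{g}$ is simple if and only if for every nonzero subspace $S$ of $\mathfrak{g}$, either $[S,\mathfrak{g}]=\mathfrak{g}$ or $[S,\mathfrak{g}]\subsetneq[[S,\mathfrak{g}],\mathfrak{g}]$.
   Context: For subspaces $U,V$ of a Lie algebra, $[U,V]$ denotes the linear span of all $[u,v]$ with $u\in U$, $v\in V$. A Lie algebra is simple if it is not abelian and its only ideals are $0$ and itself. The whole space $S=\mathfrak{g}$ is allowed as a subspace. *)

theory Defs
  imports Complex_Main
begin

text \<open>
  A Lie algebra over a field: the whole type \<open>'b\<close> is the underlying space, so its dimension is
  arbitrary. The bracket is required to be alternating, not merely antisymmetric, since
  characteristic 2 is allowed.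
\<close>

locale lie_algebra = vector_space scale
  for scale :: "'a::field \<Rightarrow> 'b::ab_group_add \<Rightarrow> 'b" +
  fixes bracket :: "'b \<Rightarrow> 'b \<Rightarrow> 'b"
  assumes bracket_add_left: "bracket (x + y) z = bracket x z + bracket y z"
    and bracket_add_right: "bracket x (y + z) = bracket x y + bracket x z"
    and bracket_scale_left: "bracket (scale c x) y = scale c (bracket x y)"
    and bracket_scale_right: "bracket x (scale c y) = scale c (bracket x y)"
    and bracket_self: "bracket x x = 0"
    and jacobi: "bracket x (bracket y z) + bracket y (bracket z x) + bracket z (bracket x y) = 0"
begin

definition bracket_space :: "'b set \<Rightarrow> 'b set \<Rightarrow> 'b set" where
  "bracket_space U V = span {bracket u v | u v. u \<in> U \<and> v \<in> V}"

definition abelian :: bool where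
  "abelian \<longleftrightarrow> (\<forall>x y. bracket x y = 0)"

text \<open>Left and right ideals coincide because the bracket is antisymmetric.\<close>

definition lie_ideal :: "'b set \<Rightarrow> bool" where
  "lie_ideal I \<longleftrightarrow> subspace I \<and> (\<forall>x. \<forall>y\<in>I. bracket x y \<in> I)"

definition simple :: bool where
  "simple \<longleftrightarrow> \<not> abelian \<and> (\<forall>I. lie_ideal I \<longrightarrow> I = {0} \<or> I = UNIV)"

end

end

theory Submission
  imports Defs
begin

text \<open>
  The Jacobi identity gives \<open>[S,[\<gg>,\<gg>]] \<subseteq> [[S,\<gg>],\<gg>]\<close>. If \<open>\<gg>\<close> is simple, then
  \<open>[\<gg>,\<gg>] = \<gg>\<close>, so \<open>T = [S,\<gg>]\<close> satisfies \<open>T \<subseteq> [T,\<gg>]\<close>, and equality makes \<open>T\<close> an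
  ideal; it is nonzero because the centre is an ideal and hence trivial. Conversely a nonzero
  ideal \<open>I\<close> satisfies \<open>[[I,\<gg>],\<gg>] \<subseteq> [I,\<gg>] \<subseteq> I\<close>, so the strict inclusion fails and
  \<open>I = \<gg>\<close>; for \<open>I = \<gg>\<close> itself the condition excludes that \<open>\<gg>\<close> is abelian.
\<close>

context lie_algebra
begin

lemma bracket_zero_left [simp]: "bracket 0 x = 0"
  using bracket_add_left[of 0 0 x] by simp

lemma bracket_zero_right [simp]: "bracket x 0 = 0"
  using bracket_add_right[of x 0 0] by simp

lemma bracket_antisym: "bracket x y = - bracket y x"
proof -
  have "bracket (x + y) (x + y) = 0" by (rule bracket_self)
  then have "bracket x y + bracket y x = 0"
    by (simp add: bracket_add_left bracket_add_right add.commute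
        bracket_self[of x] bracket_self[of y])
  then show ?thesis by (simp add: eq_neg_iff_add_eq_0)
qed

lemma subspace_bracket_space: "subspace (bracket_space U V)"
  unfolding bracket_space_def by (rule subspace_span)

lemma bracket_in_bracket_space: "u \<in> U \<Longrightarrow> v \<in> V \<Longrightarrow> bracket u v \<in> bracket_space U V"
  unfolding bracket_space_def by (rule span_base) blast

lemma bracket_space_least:
  assumes "subspace W" and "\<And>u v. u \<in> U \<Longrightarrow> v \<in> V \<Longrightarrow> bracket u v \<in> W"
  shows "bracket_space U V \<subseteq> W"
  unfolding bracket_space_def by (rule span_minimal) (use assms in auto)

lemma bracket_space_mono:
  "U \<subseteq> U' \<Longrightarrow> V \<subseteq> V' \<Longrightarrow> bracket_space U V \<subseteq> bracket_space U' V'"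
  by (rule bracket_space_least[OF subspace_bracket_space])
    (auto intro: bracket_in_bracket_space)

text \<open>Antisymmetry swaps the two factors, and a subspace absorbs the sign. In this form,
  ideals can be compared directly with bracket spaces.\<close>

lemma lie_ideal_iff: "lie_ideal I \<longleftrightarrow> subspace I \<and> bracket_space I UNIV \<subseteq> I"
proof
  assume "lie_ideal I"
  then show "subspace I \<and> bracket_space I UNIV \<subseteq> I"
    unfolding lie_ideal_def
    by (metis bracket_antisym bracket_space_least subspace_neg)
next
  assume "subspace I \<and> bracket_space I UNIV \<subseteq> I"
  then show "lie_ideal I"
    unfolding lie_ideal_def
    by (metis UNIV_I bracket_antisym bracket_in_bracket_space subset_iff subspace_neg)
qed

lemma lie_ideal_derived: "lie_ideal (bracket_space UNIV UNIV)"
  by (simp add: lie_ideal_iff subspace_bracket_space bracket_space_mono)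

lemma lie_ideal_centre: "lie_ideal {x. \<forall>y. bracket x y = 0}"
proof -
  \<comment> \<open>A central element is killed from either side, and 0 is central.\<close>
  have "bracket x y = 0" if "\<forall>z. bracket y z = 0" for x y
    using that bracket_antisym[of x y] by simp
  then show ?thesis
    unfolding lie_ideal_def subspace_def
    by (auto simp: bracket_add_left bracket_scale_left)
qed

lemma simple_derived:
  assumes "simple"
  shows "bracket_space UNIV UNIV = UNIV"
proof -
  obtain x y where "bracket x y \<noteq> 0"
    using assms unfolding simple_def abelian_def by blast
  then have "bracket_space UNIV UNIV \<noteq> {0}"
    using bracket_in_bracket_space[of x UNIV y UNIV] by auto
  then show ?thesis
    using assms lie_ideal_derived unfolding simple_def by blast
qed

lemma simple_centre:
  assumes "simple"
  shows "{x. \<forall>y. bracket x y = 0} = {0}"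
  using assms lie_ideal_centre unfolding simple_def abelian_def by blast

lemma bracket_space_derived_subset:
  "bracket_space S (bracket_space UNIV UNIV) \<subseteq> bracket_space (bracket_space S UNIV) UNIV"
    (is "_ \<subseteq> ?W")
proof (rule bracket_space_least[OF subspace_bracket_space])
  fix s v assume s: "s \<in> S" and v: "v \<in> bracket_space UNIV UNIV"
  \<comment> \<open>For fixed \<open>s\<close>, the admissible \<open>v\<close> form a subspace, so
    it suffices to check the generators \<open>bracket y z\<close>.\<close>
  have "bracket_space UNIV UNIV \<subseteq> {v. bracket s v \<in> ?W}"
  proof (rule bracket_space_least)
    show "subspace {v. bracket s v \<in> ?W}"
      using subspace_bracket_space[of "bracket_space S UNIV" UNIV] unfolding subspace_def
      by (simp add: bracket_add_right bracket_scale_right)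
  next
    fix y z
    have "bracket s (bracket y z) = bracket (bracket s y) z - bracket (bracket s z) y"
    proof -
      \<comment> \<open>Two sign changes cancel: one inside, with scalar -1 pulled out, and one
        outside.\<close>
      have "bracket y (bracket z s) = bracket (bracket s z) y"
        by (metis bracket_antisym bracket_scale_right scale_minus_left scale_one)
      moreover have "bracket z (bracket s y) = - bracket (bracket s y) z"
        by (rule bracket_antisym)
      ultimately show ?thesis
        using jacobi[of s y z] by (simp add: algebra_simps)
    qed
    then show "bracket y z \<in> {v. bracket s v \<in> ?W}"
      using s by (simp add: subspace_diff subspace_bracket_space bracket_in_bracket_space)
  qed
  then show "bracket s v \<in> ?W" using v by blast
qed

lemma simple_bracket_space_psubset:
  assumes "simple" and "subspace S" and "S \<noteq> {0}" and "bracket_space S UNIV \<noteq> UNIV"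
  shows "bracket_space S UNIV \<subset> bracket_space (bracket_space S UNIV) UNIV"
proof -
  let ?T = "bracket_space S UNIV"
  obtain s where s: "s \<in> S" "s \<noteq> 0"
    using assms(2,3) subspace_0 by blast
  then obtain y where "bracket s y \<noteq> 0"
    using simple_centre[OF assms(1)] by blast
  then have "?T \<noteq> {0}"
    using bracket_in_bracket_space[OF s(1), of y UNIV] by auto
  then have "\<not> lie_ideal ?T"
    using assms(1,4) unfolding simple_def by blast
  \<comment> \<open>As \<open>?T\<close> is a subspace, this is the only way it can fail to be an
    ideal; it makes the inclusion below strict.\<close>
  then have "\<not> bracket_space ?T UNIV \<subseteq> ?T"
    by (simp add: lie_ideal_iff subspace_bracket_space)
  moreover have "?T \<subseteq> bracket_space ?T UNIV"
    \<comment> \<open>Replacing the derived algebra by the whole algebra turns the left side of the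
      Jacobi inclusion into \<open>?T\<close>.\<close>
    using bracket_space_derived_subset[of S] by (simp add: simple_derived[OF assms(1)])
  ultimately show ?thesis by blast
qed

lemma simpleI:
  assumes "(UNIV :: 'b set) \<noteq> {0}"
    and S: "\<And>S. subspace S \<Longrightarrow> S \<noteq> {0} \<Longrightarrow> bracket_space S UNIV = UNIV \<or>
      bracket_space S UNIV \<subset> bracket_space (bracket_space S UNIV) UNIV"
  shows "simple"
  unfolding simple_def
proof (intro conjI allI impI)
  show "\<not> abelian"
  proof
    assume "abelian"
    then have "bracket_space U V \<subseteq> {0}" for U V
      by (intro bracket_space_least) (auto simp: abelian_def)
    then have "bracket_space U V = {0}" for U V
      using subspace_0[OF subspace_bracket_space] by blast
    then show False
      \<comment> \<open>Both bracket spaces are \<open>{0}\<close>: not the whole space, and not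
        strictly inside itself.\<close>
      using S[of UNIV] assms(1) by auto
  qed
next
  fix I assume I: "lie_ideal I"
  then have "subspace I" and le: "bracket_space I UNIV \<subseteq> I"
    by (simp_all add: lie_ideal_iff)
  moreover have "bracket_space (bracket_space I UNIV) UNIV \<subseteq> bracket_space I UNIV"
    using le by (rule bracket_space_mono) simp
  \<comment> \<open>For nonzero \<open>I\<close> only the first alternative survives, and then
    \<open>le\<close> forces \<open>I\<close> to be everything.\<close>
  ultimately show "I = {0} \<or> I = UNIV"
    using S[of I] by blast
qed

end

theorem theorem6p2:
  fixes scale :: "'a::field \<Rightarrow> 'b::ab_group_add \<Rightarrow> 'b"
    and bracket :: "'b \<Rightarrow> 'b \<Rightarrow> 'b"
  assumes "lie_algebra scale bracket"
    and "(UNIV :: 'b set) \<noteq> {0}"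
  shows "lie_algebra.simple scale bracket \<longleftrightarrow>
    (\<forall>S. module.subspace scale S \<and> S \<noteq> {0} \<longrightarrow>
      lie_algebra.bracket_space scale bracket S UNIV = UNIV \<or>
      lie_algebra.bracket_space scale bracket S UNIV
        \<subset> lie_algebra.bracket_space scale bracket
            (lie_algebra.bracket_space scale bracket S UNIV) UNIV)"
proof -
  interpret lie_algebra scale bracket by (rule assms(1))
  show ?thesis
    using simple_bracket_space_psubset simpleI[OF assms(2)] by blast
qed

end
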